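(* There exists a finitely generated infinite torsion group; that is, there exists an infinite group $G$ which is generated by a finite set and in which every element has finite order.
   Context: A group $G$ is torsion (or periodic) if every element of $G$ has finite order. *)

theory Defs
  imports "HOL-Algebra.Algebra"
begin

definition finitely_generated_group :: "('a, 'b) monoid_scheme \<Rightarrow> bool" where
  "finitely_generated_group G \<longleftrightarrow>
     group G \<and> (\<exists>S. finite S \<and> S \<subseteq> carrier G \<and> generate G S = carrier G)"

definition torsion_group :: "('a, 'b) monoid_scheme \<Rightarrow> bool" where
  "torsion_group G \<longleftrightarrow>
     group G \<and> (\<forall>x \<in> carrier G. \<exists>n::nat. n > 0 \<and> x [^]\<^bsub>G\<^esub> n = \<one>\<^bsub>G\<^esub>)"

end

theory Submission
  imports Defs "HOL-Library.Numeral_Type" "HOL-Library.Countable_Set"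
begin

text \<open>
  The group is the Gupta--Sidki \<open>3\<close>-group, acting on words over \<open>\<int>/3\<close>: it is generated by the
  rotation \<open>a\<close> of the first letter and by \<open>t\<close> with sections \<open>(t, a, a\<^sup>-\<^sup>1)\<close>. Every element is
  \<open>t\<^sub>i\<^sub>1 \<dots> t\<^sub>i\<^sub>n a\<^sup>k\<close>, where \<open>t\<^sub>i = a\<^sup>i t a\<^sup>-\<^sup>i\<close>. If \<open>k = 0\<close>, the section at \<open>x\<close> is such a
  product whose length is the number of \<open>j\<close> with \<open>i\<^sub>j = x\<close>; so either all sections are shorter than \<open>n\<close>,
  or the element is a power of \<open>t\<^sub>x\<close>, which has order \<open>3\<close>. If \<open>k \<noteq> 0\<close>, the sections of the cube
  have length at most \<open>n\<close> and exponent of \<open>a\<close> equal to \<open>0\<close>, because the \<open>a\<close>-exponents of the three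
  sections of \<open>t\<close> sum to \<open>0\<close>. Torsion follows by induction on \<open>n\<close>. The group is infinite because the
  elements with \<open>k = 0\<close> form a proper subset which is mapped onto the whole group by the section at \<open>0\<close>.
\<close>

section \<open>Letters and rotations\<close>

lemma three_eq_0: "(3::3) = 0"
  by simp

lemma three_mult [simp]: "3 * (x::3) = 0"
  by (simp only: three_eq_0 mult_zero_left)

lemma triple_eq_0: "(x::3) + (x + x) = 0"
proof -
  have "x + (x + x) = (1 + 1 + 1) * x" by (simp only: distrib_right mult_1_left add.assoc)
  then show ?thesis by (simp only: one_add_one numeral_plus_one add_num_simps three_mult)
qed

lemma minus_eq_double: "- (x::3) = x + x"
  using triple_eq_0[of x] by (simp add: add_eq_0_iff)

lemma double_eq_0_iff: "(x::3) + x = 0 \<longleftrightarrow> x = 0"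
  using minus_eq_double[of x] by (metis neg_equal_0_iff_equal)

primrec rot :: "3 \<Rightarrow> 3 list \<Rightarrow> 3 list" where
  "rot k [] = []"
| "rot k (x # w) = (x + k) # w"

lemma rot_0 [simp]: "rot 0 = id"
proof
  show "rot 0 w = id w" for w by (cases w) auto
qed

lemma rot_rot [simp]: "rot k (rot l w) = rot (k + l) w"
  by (cases w) (auto simp: algebra_simps)

lemma rot_funpow: "rot k ^^ n = rot (of_nat n * k)"
  by (induction n) (auto simp: fun_eq_iff algebra_simps)

text \<open>This is \<open>t\<close>: a letter of \<int>/3 doubles as the exponent of the rotation
  below it, so the sections at 0, 1, 2 are \<open>t\<close>, \<open>a\<close>,
  \<open>a\<^sup>-\<^sup>1\<close>.\<close>

primrec spin :: "3 list \<Rightarrow> 3 list" where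
  "spin [] = []"
| "spin (x # w) = x # (if x = 0 then spin w else rot x w)"

definition spin_at :: "3 \<Rightarrow> 3 list \<Rightarrow> 3 list" where
  "spin_at i = rot i \<circ> spin \<circ> rot (- i)"

lemma spin_at_0 [simp]: "spin_at 0 = spin"
  by (simp add: spin_at_def)

lemma spin_at_Nil [simp]: "spin_at i [] = []"
  by (simp add: spin_at_def)

lemma spin_at_Cons [simp]:
  "spin_at i (x # w) = x # (if x = i then spin w else rot (x - i) w)"
  by (simp add: spin_at_def)

lemma rot_spin_at: "rot k (spin_at i w) = spin_at (k + i) (rot k w)"
  by (cases w) (auto simp: algebra_simps)

lemma spin_cube: "spin (spin (spin w)) = w"
proof (induction w)
  case (Cons x w)
  then show ?case using triple_eq_0[of x] by (simp add: add.assoc)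
qed simp

lemma spin_at_cube: "spin_at i ^^ 3 = id"
proof
  show "(spin_at i ^^ 3) w = id w" for w
    by (cases w) (auto simp: numeral_3_eq_3 spin_cube triple_eq_0)
qed

section \<open>Elements of the group and their sections\<close>

text \<open>The form \<open>t\<^sub>i\<^sub>1 \<dots> t\<^sub>i\<^sub>n a\<^sup>k\<close>, which is
  not unique; torsion is proved by induction on the length of \<open>u\<close>.\<close>

primrec elt :: "3 list \<Rightarrow> 3 \<Rightarrow> 3 list \<Rightarrow> 3 list" where
  "elt [] k = rot k"
| "elt (i # u) k = spin_at i \<circ> elt u k"

lemma elt_Nil [simp]: "elt u k [] = []"
  by (induction u) auto

lemma rot_elt: "rot k (elt u l w) = elt (map ((+) k) u) (k + l) w"
  by (induction u) (auto simp: rot_spin_at)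

lemma elt_comp: "elt u k (elt v l w) = elt (u @ map ((+) k) v) (k + l) w"
  by (induction u) (auto simp: rot_elt)

text \<open>A factor \<open>t\<^sub>i\<close> with \<open>i = x\<close> contributes
  \<open>t\<^sub>0\<close>; any other contributes a rotation, which moves to the right end and
  shifts the indices it passes. \<open>sec_exp\<close> collects these rotations.\<close>

primrec sec :: "3 \<Rightarrow> 3 list \<Rightarrow> 3 list" where
  "sec x [] = []"
| "sec x (i # u) = (if i = x then 0 # sec x u else map ((+) (x - i)) (sec x u))"

definition sec_exp :: "3 \<Rightarrow> 3 list \<Rightarrow> 3" where
  "sec_exp x u = (\<Sum>i\<leftarrow>u. x - i)"

text \<open>\<open>rot k\<close> acts first, so the section is taken at \<open>x + k\<close>, a
  letter that every \<open>spin_at i\<close> then fixes.\<close>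

lemma elt_Cons:
  "elt u k (x # w) = (x + k) # elt (sec (x + k) u) (sec_exp (x + k) u) w"
  by (induction u) (auto simp: rot_elt sec_exp_def)

lemma length_sec: "length (sec x u) = count_list u x"
  by (induction u) auto

text \<open>Each entry \<open>i\<close> contributes three times \<open>x + k - i\<close>, which
  vanishes in \<int>/3.\<close>

lemma sum_sec_exp: "sec_exp x u + sec_exp (x + k + k) u + sec_exp (x + k) u = 0"
proof (induction u)
  case (Cons i u)
  have "(x - i) + (x + k + k - i) + (x + k - i) = (x + k - i) + ((x + k - i) + (x + k - i))"
    by (simp add: algebra_simps)
  with Cons triple_eq_0[of "x + k - i"] show ?case
    by (simp add: sec_exp_def algebra_simps)
qed (simp add: sec_exp_def)

text \<open>The three letters are distinct for nonzero \<open>k\<close>, so each entry of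
  \<open>u\<close> is counted at most once.\<close>

lemma sum_count_list_le:
  fixes k :: 3
  assumes "k \<noteq> 0"
  shows "count_list u x + count_list u (x + k + k) + count_list u (x + k) \<le> length u"
  using assms double_eq_0_iff[of k] by (induction u) (auto simp: add.assoc)

section \<open>Torsion\<close>

definition fin_ord :: "('a \<Rightarrow> 'a) \<Rightarrow> bool" where
  "fin_ord f \<longleftrightarrow> (\<exists>n>0. f ^^ n = id)"

lemma fin_ord_funpowD:
  assumes "fin_ord (f ^^ m)" "m > 0"
  shows "fin_ord f"
proof -
  obtain n where "n > 0" "(f ^^ m) ^^ n = id" using assms by (auto simp: fin_ord_def)
  then have "f ^^ (m * n) = id" "m * n > 0" using \<open>m > 0\<close> by (auto simp: funpow_mult mult.commute)
  then show ?thesis unfolding fin_ord_def by blast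
qed

text \<open>Powers of \<open>f\<close> act section by section, and over a finite alphabet the
  exponents of all sections have a common multiple.\<close>

lemma fin_ord_sections:
  fixes g :: "'a::finite \<Rightarrow> 'a list \<Rightarrow> 'a list"
  assumes Nil: "f [] = []" and Cons: "\<And>x w. f (x # w) = x # g x w"
    and fin: "\<And>x. fin_ord (g x)"
  shows "fin_ord f"
proof -
  from fin obtain n where n: "\<And>x. n x > 0" "\<And>x. g x ^^ n x = id"
    unfolding fin_ord_def by metis
  define N where "N = (\<Prod>x\<in>UNIV. n x)"
  have pow: "(f ^^ m) [] = []" "(f ^^ m) (x # w) = x # (g x ^^ m) w" for m x w
    by (induction m) (auto simp: Nil Cons)
  have "g x ^^ N = id" for x
  proof -
    have "n x dvd N" unfolding N_def by (rule dvd_prodI) auto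
    then obtain m where "N = n x * m" by (auto elim: dvdE)
    then have "g x ^^ N = (g x ^^ n x) ^^ m" by (simp add: funpow_mult mult.commute)
    then show ?thesis using n by (simp add: id_funpow)
  qed
  then have "(f ^^ N) w = id w" for w by (cases w) (auto simp: pow)
  moreover have "N > 0" using n by (auto simp: N_def intro: prod_pos)
  ultimately show ?thesis unfolding fin_ord_def by blast
qed

lemma elt_replicate: "elt (replicate n x) 0 = spin_at x ^^ n"
  by (induction n) auto

lemma fin_ord_spin_at_funpow: "fin_ord (spin_at x ^^ n)"
proof -
  have "(spin_at x ^^ n) ^^ 3 = (spin_at x ^^ 3) ^^ n"
    by (simp add: funpow_mult mult.commute)
  then have "(spin_at x ^^ n) ^^ 3 = id" by (simp add: spin_at_cube id_funpow)
  then show ?thesis unfolding fin_ord_def by (intro exI[of _ 3]) simp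
qed

lemma fin_ord_elt_0:
  assumes IH: "\<And>v l. length v < length u \<Longrightarrow> fin_ord (elt v l)"
  shows "fin_ord (elt u 0)"
\<comment> \<open>The empty \<open>u\<close> falls under the first case, as the zeroth power of any
  \<open>spin_at x\<close>.\<close>
proof (cases "\<exists>x. count_list u x = length u")
  case True
  then obtain x where "count_list u x = length u" by blast
  then have "\<forall>y\<in>set u. y = x"
  proof (induction u)
    case (Cons i u)
    then show ?case using count_le_length[of u x] by (auto split: if_splits)
  qed simp
  then have "u = replicate (length u) x" by (simp add: replicate_length_same)
  then show ?thesis by (metis elt_replicate fin_ord_spin_at_funpow)
next
  case False
  then have "length (sec x u) < length u" for x
    using count_le_length[of u x] by (simp add: length_sec le_neq_implies_less)
  then show ?thesis
    by (rule_tac g = "\<lambda>x. elt (sec x u) (sec_exp x u)" in fin_ord_sections)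
      (simp_all add: elt_Cons IH)
qed

lemma fin_ord_elt: "fin_ord (elt u k)"
proof (induction "length u" arbitrary: u k rule: less_induct)
  case less
  show ?case
  proof (cases "k = 0")
    case True
    then show ?thesis using fin_ord_elt_0 less by blast
  next
    case False
    have "\<exists>v. length v \<le> length u \<and> (\<forall>w. (elt u k ^^ 3) (x # w) = x # elt v 0 w)" for x
    proof -
      let ?s = "\<lambda>y. sec y u" and ?e = "\<lambda>y. sec_exp y u"
      \<comment> \<open>The three applications lead through \<open>x + k\<close>,
        \<open>x + k + k\<close> and back to \<open>x\<close>; \<open>?v\<close> is the word that
        \<open>elt_comp\<close> gives for the composite of the sections met there.\<close>
      let ?v = "?s x @ map ((+) (?e x)) (?s (x + k + k) @ map ((+) (?e (x + k + k))) (?s (x + k)))"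
      have "length ?v \<le> length u"
        using sum_count_list_le[OF False, of u x] by (simp add: length_sec)
      moreover have "(elt u k ^^ 3) (x # w) = x # elt ?v 0 w" for w
      proof -
        have x: "x + k + k + k = x" using triple_eq_0[of k] by (simp add: add.assoc)
        have "(elt u k ^^ 3) (x # w) =
          (x + k + k + k) # elt (?s (x + k + k + k)) (?e (x + k + k + k))
            (elt (?s (x + k + k)) (?e (x + k + k)) (elt (?s (x + k)) (?e (x + k)) w))"
          by (simp add: numeral_3_eq_3 elt_Cons)
        also have "\<dots> = x # elt ?v (?e x + (?e (x + k + k) + ?e (x + k))) w"
          unfolding x by (simp only: elt_comp)
        also have "?e x + (?e (x + k + k) + ?e (x + k)) = 0"
          using sum_sec_exp[of x u k] by (simp only: add.assoc)
        finally show ?thesis .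
      qed
      ultimately show ?thesis by blast
    qed
    then obtain v where v: "\<And>x. length (v x) \<le> length u"
      "\<And>x w. (elt u k ^^ 3) (x # w) = x # elt (v x) 0 w" by metis
    \<comment> \<open>Equal length is harmless: the exponent is 0, and \<open>fin_ord_elt_0\<close>
      appeals only to words strictly shorter than \<open>v x\<close>.\<close>
    have "fin_ord (elt (v x) 0)" for x
      by (intro fin_ord_elt_0 less) (use v(1)[of x] in simp)
    then have "fin_ord (elt u k ^^ 3)"
      by (rule_tac g = "\<lambda>x. elt (v x) 0" in fin_ord_sections)
        (simp_all add: v(2), simp add: numeral_3_eq_3)
    then show ?thesis by (rule fin_ord_funpowD) simp
  qed
qed

section \<open>The Gupta--Sidki group\<close>

definition gupta_sidki :: "(3 list \<Rightarrow> 3 list) monoid" where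
  "gupta_sidki = \<lparr>carrier = range (case_prod elt), monoid.mult = (\<circ>), one = id\<rparr>"

lemma gupta_sidki_simps [simp]:
  "monoid.mult gupta_sidki = (\<circ>)" "one gupta_sidki = id"
  by (simp_all add: gupta_sidki_def)

lemma carrier_gupta_sidki: "f \<in> carrier gupta_sidki \<longleftrightarrow> (\<exists>u k. f = elt u k)"
  by (auto simp: gupta_sidki_def)

lemma elt_in_carrier [simp]: "elt u k \<in> carrier gupta_sidki"
  by (auto simp: carrier_gupta_sidki)

lemma rot_in_carrier [simp]: "rot k \<in> carrier gupta_sidki"
  using elt_in_carrier[of "[]" k] by simp

lemma spin_in_carrier [simp]: "spin \<in> carrier gupta_sidki"
  using elt_in_carrier[of "[0]" 0] by simp

lemma id_in_carrier [simp]: "id \<in> carrier gupta_sidki"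
  using rot_in_carrier[of 0] by simp

lemma comp_in_carrier:
  assumes "f \<in> carrier gupta_sidki" "g \<in> carrier gupta_sidki"
  shows "f \<circ> g \<in> carrier gupta_sidki"
proof -
  obtain u k v l where "f = elt u k" "g = elt v l"
    using assms by (auto simp: carrier_gupta_sidki)
  then have "f \<circ> g = elt (u @ map ((+) k) v) (k + l)"
    by (simp add: fun_eq_iff elt_comp)
  then show ?thesis by (simp only: elt_in_carrier)
qed

lemma pow_gupta_sidki: "f [^]\<^bsub>gupta_sidki\<^esub> (n::nat) = f ^^ n"
  by (induction n) (simp_all add: nat_pow_def funpow_swap1 fun_eq_iff)

lemma funpow_in_carrier: "f \<in> carrier gupta_sidki \<Longrightarrow> f ^^ n \<in> carrier gupta_sidki"
  by (induction n) (simp_all add: comp_in_carrier)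

lemma fin_ord_carrier: "f \<in> carrier gupta_sidki \<Longrightarrow> fin_ord f"
  by (auto simp: carrier_gupta_sidki fin_ord_elt)

text \<open>Torsion supplies the inverses: if \<open>f ^^ n = id\<close> with \<open>n > 0\<close>,
  then \<open>f ^^ (n - 1)\<close> inverts \<open>f\<close>.\<close>

lemma group_gupta_sidki: "group gupta_sidki"
proof (rule groupI)
  fix f assume f: "f \<in> carrier gupta_sidki"
  then obtain n where "n > 0" "f ^^ n = id" using fin_ord_carrier by (auto simp: fin_ord_def)
  then have "f ^^ (n - 1) \<circ> f = id" by (metis Suc_pred' funpow_Suc_right)
  then show "\<exists>g\<in>carrier gupta_sidki. g \<otimes>\<^bsub>gupta_sidki\<^esub> f = \<one>\<^bsub>gupta_sidki\<^esub>"
    using funpow_in_carrier[OF f] by auto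
qed (auto simp: comp_in_carrier comp_assoc)

lemma torsion_group_gupta_sidki: "torsion_group gupta_sidki"
  using fin_ord_carrier
  by (auto simp: torsion_group_def group_gupta_sidki fin_ord_def pow_gupta_sidki)

text \<open>Every rotation is a positive power of \<open>rot 1\<close>, so composition alone builds
  all elements from the two generators.\<close>

lemma gupta_sidki_induct [consumes 1, case_names rot spin comp]:
  assumes "f \<in> carrier gupta_sidki"
    and rot: "P (rot 1)" and spin: "P spin" and comp: "\<And>f g. P f \<Longrightarrow> P g \<Longrightarrow> P (f \<circ> g)"
  shows "P f"
proof -
  have pow: "P (rot 1 ^^ Suc n)" for n
  proof (induction n)
    case (Suc n)
    then show ?case using comp[OF rot Suc] by (simp only: funpow.simps)
  qed (simp add: rot)
  have rot_k: "P (rot k)" for k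
  proof (cases k)
    case (of_int z)
    \<comment> \<open>The exponent is \<open>z + 3\<close>: same residue as \<open>z\<close>, but
      positive even for \<open>k = 0\<close>.\<close>
    have "k = of_nat (Suc (nat z + 2))"
      using of_int three_eq_0 by simp
    then show ?thesis using pow[of "nat z + 2"] by (simp only: rot_funpow mult_1_right)
  qed
  have "P (spin_at i)" for i
    unfolding spin_at_def by (intro comp rot_k spin)
  then have "P (elt u k)" for u k
    by (induction u) (simp_all add: rot_k comp)
  then show ?thesis using assms(1) by (auto simp: carrier_gupta_sidki)
qed

lemma finitely_generated_gupta_sidki: "finitely_generated_group gupta_sidki"
proof -
  let ?S = "{rot 1, spin}"
  have "f \<in> generate gupta_sidki ?S" if "f \<in> carrier gupta_sidki" for f
    using that
  proof (induction rule: gupta_sidki_induct)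
    case (comp f g)
    then show ?case using generate.eng[of f gupta_sidki ?S g] by (simp only: gupta_sidki_simps)
  qed (auto intro: generate.incl)
  moreover have "generate gupta_sidki ?S \<subseteq> carrier gupta_sidki"
    by (rule group.generate_incl[OF group_gupta_sidki]) simp
  ultimately have "generate gupta_sidki ?S = carrier gupta_sidki" by blast
  then show ?thesis
    unfolding finitely_generated_group_def using group_gupta_sidki
    by (intro conjI exI[of _ ?S]) auto
qed

lemma infinite_gupta_sidki: "infinite (carrier gupta_sidki)"
proof
  assume fin: "finite (carrier gupta_sidki)"
  \<comment> \<open>\<open>S\<close> is the stabilizer of the first letter.\<close>
  define S where "S = {f \<in> carrier gupta_sidki. \<forall>x w. hd (f (x # w)) = x}"
  define section0 where "section0 f w = tl (f (0 # w))" for f :: "3 list \<Rightarrow> 3 list" and w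
  have surj: "\<exists>f\<in>S. \<forall>w. f (0 # w) = 0 # h w" if "h \<in> carrier gupta_sidki" for h
    using that
  proof (induction rule: gupta_sidki_induct)
    case rot
    \<comment> \<open>The index -1 makes the section at 0 equal to \<open>rot (0 - (- 1))\<close>,
      that is \<open>rot 1\<close>.\<close>
    have "spin_at (- 1) \<in> S" unfolding S_def using elt_in_carrier[of "[- 1]" 0] by simp
    then show ?case by (auto intro!: bexI[of _ "spin_at (- 1)"])
  next
    case spin
    have "spin \<in> S" unfolding S_def by simp
    then show ?case by (auto intro!: bexI[of _ spin])
  next
    case (comp h h')
    then obtain f f' where f: "f \<in> S" "\<And>w. f (0 # w) = 0 # h w"
      and f': "f' \<in> S" "\<And>w. f' (0 # w) = 0 # h' w" by auto
    have "hd (f (f' (x # w))) = x" for x w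
    proof -
      \<comment> \<open>Membership in \<open>S\<close> speaks of \<open>hd\<close> only; the form
        \<open>elt v k\<close> shows that the image is a nonempty word.\<close>
      obtain v k where "f' = elt v k" using f'(1) by (auto simp: S_def carrier_gupta_sidki)
      then obtain w' where "f' (x # w) = x # w'"
        using f'(1) by (auto simp: S_def elt_Cons)
      then show ?thesis using f(1) by (simp add: S_def)
    qed
    then have "f \<circ> f' \<in> S"
      using f(1) f'(1) by (simp add: S_def comp_in_carrier)
    then show ?case using f f' by (auto intro!: bexI[of _ "f \<circ> f'"])
  qed
  have "carrier gupta_sidki \<subseteq> section0 ` S"
  proof
    fix h assume "h \<in> carrier gupta_sidki"
    then obtain f where f: "f \<in> S" "\<And>w. f (0 # w) = 0 # h w" using surj by blast
    then have "h = section0 f" by (simp add: section0_def fun_eq_iff)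
    with f show "h \<in> section0 ` S" by blast
  qed
  moreover have "rot 1 \<notin> S" by (simp add: S_def)
  then have "S \<subset> carrier gupta_sidki" unfolding S_def using rot_in_carrier by blast
  then have "card S < card (carrier gupta_sidki)" "finite S"
    using fin by (auto intro: psubset_card_mono finite_subset)
  ultimately show False using surj_card_le[of S "carrier gupta_sidki" section0] by simp
qed

lemma countable_gupta_sidki: "countable (carrier gupta_sidki)"
proof -
  have "carrier gupta_sidki = case_prod elt ` (UNIV \<times> UNIV)" by (simp add: gupta_sidki_def)
  moreover have "countable (UNIV :: 3 list set)"
    using countable_lists[of "UNIV :: 3 set"] by (simp add: countable_finite)
  ultimately show ?thesis by (simp add: countable_finite)
qed

section \<open>Transport to the natural numbers\<close>

text \<open>Countability gives an injection \<open>h\<close> of the carrier into \<nat>, along which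
  the multiplication is copied.\<close>

lemma (in group) countable_group_on_nat:
  assumes "countable (carrier G)"
  obtains H :: "nat monoid" and h where "group H" "h \<in> iso G H"
proof -
  define h where "h = to_nat_on (carrier G)"
  define g where "g = inv_into (carrier G) h"
  have inj: "inj_on h (carrier G)" unfolding h_def using assms by (rule inj_on_to_nat_on)
  define H where "H = \<lparr>carrier = h ` carrier G, monoid.mult = (\<lambda>x y. h (g x \<otimes> g y)), one = h \<one>\<rparr>"
  have iso: "h \<in> iso G H"
    by (rule isoI) (auto simp: hom_def H_def g_def inj bij_betw_def)
  \<comment> \<open>\<open>iso_imp_img_group\<close> yields \<open>H\<close> with its unit reset to
    \<open>h \<one>\<close>, which is already its unit.\<close>
  have "H\<lparr>one := h \<one>\<rparr> = H" by (simp add: H_def)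
  with iso_imp_img_group[OF iso] have "group H" by simp
  with iso show ?thesis using that by blast
qed

text \<open>Homomorphisms commute with \<open>generate\<close>, and \<open>h\<close> is onto, so the
  image of a generating set generates.\<close>

lemma iso_finitely_generated_group:
  assumes "finitely_generated_group G" "group H" "h \<in> iso G H"
  shows "finitely_generated_group H"
proof -
  from assms interpret group_hom G H h
    by (auto simp: group_hom_def group_hom_axioms_def iso_def finitely_generated_group_def)
  from assms obtain S where S: "finite S" "S \<subseteq> carrier G" "generate G S = carrier G"
    by (auto simp: finitely_generated_group_def)
  have "h ` carrier G = carrier H" using assms(3) by (auto simp: iso_def bij_betw_def)
  then show ?thesis
    unfolding finitely_generated_group_def
    using S generate_img[OF S(2)] by (intro conjI assms exI[of _ "h ` S"]) auto
qed

lemma iso_torsion_group: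
  assumes "torsion_group G" "group H" "h \<in> iso G H"
  shows "torsion_group H"
proof -
  from assms interpret group_hom G H h
    by (auto simp: group_hom_def group_hom_axioms_def iso_def torsion_group_def)
  have img: "carrier H = h ` carrier G" using assms(3) by (auto simp: iso_def bij_betw_def)
  have "\<exists>n::nat. n > 0 \<and> h x [^]\<^bsub>H\<^esub> n = \<one>\<^bsub>H\<^esub>" if "x \<in> carrier G" for x
    using assms(1) that by (metis torsion_group_def hom_nat_pow hom_one)
  then show ?thesis by (auto simp: torsion_group_def img assms(2))
qed

theorem theorem2:
  shows "\<exists>G :: nat monoid.
           group G \<and> finitely_generated_group G \<and> infinite (carrier G) \<and> torsion_group G"
proof -
  obtain H :: "nat monoid" and h where H: "group H" "h \<in> iso gupta_sidki H"
    using group.countable_group_on_nat[OF group_gupta_sidki countable_gupta_sidki] .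
  have "infinite (carrier H)"
    using H(2) infinite_gupta_sidki by (auto simp: iso_def dest: bij_betw_finite)
  with H show ?thesis
    using iso_finitely_generated_group[OF finitely_generated_gupta_sidki]
      iso_torsion_group[OF torsion_group_gupta_sidki] by blast
qed

end
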